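(* For every $T>0$ and $K>0$ there exists a constant $\varepsilon=\varepsilon(T,K)>0$ such that the following holds. Let $b_1,b_2,b_3,\sigma_1,\sigma_2,f_1,f_2,f_3,h\in\mathbb R$ be constants with absolute values at most $K$, and let $$F(y)=f_1+[f_2+b_1+\sigma_1f_3]\,y+[b_2+f_3\sigma_2+b_3\sigma_1]\,y^2+\sigma_2b_3\,y^3.$$ Then the ODE $$\mathbf y_t=h+\int_t^TF(\mathbf y_s)\,ds,\qquad t\in[0,T],$$ has a bounded solution on $[0,T]$ if one of the following three cases holds true: (i) $\sigma_2b_3<0$ or $F(h)=0$; (ii) $F(h)>0$, $\ \sigma_2b_3\le\varepsilon\ $ and $\ b_2+f_3\sigma_2+b_3\sigma_1\le\varepsilon$; (iii) $F(h)<0$, $\ \sigma_2b_3\le\varepsilon\ $ and $\ b_2+f_3\sigma_2+b_3\sigma_1\ge-\varepsilon$.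
   Context: The ODE is the "dominating ODE" associated with the linear FBSDE with constant coefficients $b_i,\sigma_i,f_i$ ($i=1,2,3$, $\sigma_3=0$) and terminal coefficient $h$. The claim concerns the deterministic ODE alone. *)

theory Defs
  imports "HOL-Analysis.Analysis"
begin

definition dominating_F ::
  "real \<Rightarrow> real \<Rightarrow> real \<Rightarrow> real \<Rightarrow> real \<Rightarrow> real \<Rightarrow> real \<Rightarrow> real \<Rightarrow> real \<Rightarrow> real" where
  "dominating_F b1 b2 b3 \<sigma>1 \<sigma>2 f1 f2 f3 y =
     f1 + (f2 + b1 + \<sigma>1 * f3) * y + (b2 + f3 * \<sigma>2 + b3 * \<sigma>1) * y ^ 2 + \<sigma>2 * b3 * y ^ 3"

text \<open>
  Integrability is required explicitly, since \<^const>\<open>integral\<close> is \<open>0\<close> on non-integrable functions.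
  It makes every solution continuous on \<open>{0..T}\<close>.
\<close>

definition backward_ode_solution ::
  "(real \<Rightarrow> real) \<Rightarrow> real \<Rightarrow> real \<Rightarrow> (real \<Rightarrow> real) \<Rightarrow> bool" where
  "backward_ode_solution F h T y \<longleftrightarrow>
     (\<forall>t\<in>{0..T}. (\<lambda>s. F (y s)) integrable_on {t..T} \<and>
                 y t = h + integral {t..T} (\<lambda>s. F (y s)))"

end

theory Submission
  imports Defs
begin

text \<open>
  Reversing time, the equation is the scalar autonomous problem \<open>z' = F z\<close>, \<open>z 0 = h\<close>, which is
  solved by separation of variables: if \<open>F > 0\<close> on \<open>[h, M]\<close> and \<open>\<integral> 1/F \<ge> T\<close> over \<open>[h, M]\<close>, the
  inverse of \<open>x \<mapsto> \<integral> 1/F\<close> over \<open>[h, x]\<close> is a solution with values in \<open>[h, M]\<close>. If \<open>F\<close> has a zero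
  above \<open>h\<close>, the integral diverges at the first one because \<open>F\<close> is Lipschitz. Otherwise, for small
  \<open>\<epsilon>\<close>, \<open>F\<close> is bounded by a linear function on an interval so long that the integral
  exceeds \<open>T\<close>. The case \<open>F h < 0\<close> follows by the reflection \<open>y \<mapsto> - y\<close>.
\<close>

section \<open>Scalar autonomous equations: separation of variables\<close>

text \<open>\<open>P\<close> serves as an explicit lower bound for the travel time
  \<open>\<integral> 1/F\<close>: each application supplies an elementary logarithm and never has to
  evaluate the integral. The range of \<open>y\<close> is recorded because it yields
  boundedness.\<close>

lemma backward_ode_solution_by_separation:
  fixes F P P' :: "real \<Rightarrow> real"
  assumes "h \<le> M"
    and contF: "continuous_on {h..M} F"
    and pos: "\<And>x. x \<in> {h..M} \<Longrightarrow> F x > 0"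
    and P: "\<And>x. x \<in> {h..M} \<Longrightarrow> (P has_real_derivative P' x) (at x within {h..M})"
    and P': "\<And>x. x \<in> {h..M} \<Longrightarrow> P' x \<le> 1 / F x"
    and T: "P M - P h \<ge> T"
  shows "\<exists>y. y ` {0..T} \<subseteq> {h..M} \<and> backward_ode_solution F h T y"
proof -
  define G where "G x = integral {h..x} (\<lambda>u. 1 / F u)" for x
  define g where "g = inv_into {h..M} G"
  have contI: "continuous_on {h..M} (\<lambda>u. 1 / F u)"
    using pos by (intro continuous_intros contF) force
  have G: "(G has_real_derivative 1 / F x) (at x within {h..M})" if "x \<in> {h..M}" for x
    unfolding G_def using integral_has_real_derivative[OF contI that] .
  have contG: "continuous_on {h..M} G"
    by (rule DERIV_continuous_on[OF G])
  have G_less: "G a < G b" if "h \<le> a" "a < b" "b \<le> M" for a b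
  proof (rule DERIV_pos_imp_increasing_open[OF \<open>a < b\<close>])
    fix x assume x: "a < x" "x < b"
    with that have "(G has_real_derivative 1 / F x) (at x)"
      using G[of x] at_within_Icc_at[of h x M] by auto
    then show "\<exists>y. (G has_real_derivative y) (at x) \<and> 0 < y"
      using pos[of x] that x by auto
  next
    show "continuous_on {a..b} G"
      using that by (intro continuous_on_subset[OF contG]) auto
  qed
  then have inj: "inj_on G {h..M}"
    by (intro linorder_inj_onI') force
  have Gh: "G h = 0"
    by (simp add: G_def)
  \<comment> \<open>\<open>G - P\<close> has nonnegative derivative, so \<open>G\<close> grows by at
    least as much as \<open>P\<close>, that is, by at least \<open>T\<close>.\<close>
  have "G h - P h \<le> G M - P M"
  proof (rule DERIV_nonneg_imp_increasing_open[OF \<open>h \<le> M\<close>, of "\<lambda>x. G x - P x"])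
    fix x assume x: "h < x" "x < M"
    then have "(G has_real_derivative 1 / F x) (at x)" "(P has_real_derivative P' x) (at x)"
      using G[of x] P[of x] at_within_Icc_at[of h x M] by auto
    then have "((\<lambda>x. G x - P x) has_real_derivative 1 / F x - P' x) (at x)"
      by (rule DERIV_diff)
    then show "\<exists>y. ((\<lambda>x. G x - P x) has_real_derivative y) (at x) \<and> 0 \<le> y"
      using P'[of x] x by force
  next
    show "continuous_on {h..M} (\<lambda>x. G x - P x)"
      using contG DERIV_continuous_on[OF P] by (intro continuous_intros)
  qed
  with T Gh have GM: "T \<le> G M"
    by simp
  have sub: "{0..T} \<subseteq> G ` {h..M}"
  proof
    fix t assume "t \<in> {0..T}"
    then show "t \<in> G ` {h..M}"
      using IVT'[of G h t M] Gh GM \<open>h \<le> M\<close> contG by force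
  qed
  have gG: "g (G x) = x" if "x \<in> {h..M}" for x
    unfolding g_def using inj that by simp
  have Gg: "G (g t) = t" and g_mem: "g t \<in> {h..M}" if "t \<in> {0..T}" for t
    using sub that unfolding g_def by (blast intro: f_inv_into_f inv_into_into)+
  have contg: "continuous_on {0..T} g"
    by (rule continuous_on_subset[OF continuous_on_inv[OF contG compact_Icc] sub]) (use gG in auto)
  \<comment> \<open>Interior times suffice, since the fundamental theorem of calculus below asks
    only for continuity at the endpoints. For \<open>0 < t < T\<close> the value \<open>g t\<close>
    avoids \<open>h\<close> and \<open>M\<close>, where \<open>G\<close> has only a one-sided
    derivative.\<close>
  have g: "(g has_real_derivative F (g t)) (at t)" if t: "0 < t" "t < T" for t
  proof -
    have "h < g t"
      using g_mem[of t] Gg[of t] Gh t by (cases "g t = h") auto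
    moreover have "g t < M"
      using g_mem[of t] Gg[of t] GM t by (cases "g t = M") auto
    ultimately have "(G has_real_derivative 1 / F (g t)) (at (g t))"
      using G[of "g t"] at_within_Icc_at[of h "g t" M] by auto
    moreover have "isCont g t"
      using contg t by (intro continuous_on_interior[OF contg]) auto
    ultimately have "(g has_real_derivative inverse (1 / F (g t))) (at t)"
      using t pos[OF g_mem[of t]] Gg
      by (intro DERIV_inverse_function[where f = G and a = 0 and b = T]) auto
    then show ?thesis
      by simp
  qed
  \<comment> \<open>Reversing time turns the initial value \<open>g 0 = h\<close> into the terminal
    value \<open>y T = h\<close>.\<close>
  define y where "y t = g (T - t)" for t
  have conty: "continuous_on {0..T} y"
    unfolding y_def by (intro continuous_on_compose2[OF contg] continuous_intros) auto
  have y_mem: "y ` {0..T} \<subseteq> {h..M}"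
    using g_mem unfolding y_def by force
  have y: "(y has_real_derivative - F (y t)) (at t)" if "0 < t" "t < T" for t
  proof -
    have "((\<lambda>t. T - t) has_real_derivative - 1) (at t)"
      by (auto intro!: derivative_eq_intros)
    from DERIV_chain2[OF g this] that show ?thesis
      by (simp add: y_def[abs_def])
  qed
  have "backward_ode_solution F h T y"
    unfolding backward_ode_solution_def
  proof
    fix t assume t: "t \<in> {0..T}"
    have "((\<lambda>s. - F (y s)) has_integral y T - y t) {t..T}"
    proof (rule fundamental_theorem_of_calculus_interior)
      show "continuous_on {t..T} y"
        using t by (intro continuous_on_subset[OF conty]) auto
      show "(y has_vector_derivative - F (y x)) (at x)" if "x \<in> {t<..<T}" for x
        using y[of x] t that by (simp add: has_real_derivative_iff_has_vector_derivative)
    qed (use t in auto)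
    from has_integral_neg[OF this]
    have "((\<lambda>s. F (y s)) has_integral y t - y T) {t..T}"
      by simp
    moreover have "y T = h"
      using gG[of h] Gh \<open>h \<le> M\<close> by (simp add: y_def)
    ultimately show "(\<lambda>s. F (y s)) integrable_on {t..T} \<and> y t = h + integral {t..T} (\<lambda>s. F (y s))"
      by (auto simp: integral_unique has_integral_integrable)
  qed
  with y_mem show ?thesis
    by blast
qed

text \<open>Let \<open>c\<close> be the first point from \<open>h\<close> on with
  \<open>F c \<le> 0\<close>. The Lipschitz bound gives \<open>F x \<le> A * (c - x)\<close> below
  \<open>c\<close>, so the travel time grows logarithmically without bound as \<open>c\<close> is
  approached.\<close>

lemma backward_ode_solution_below_zero:
  fixes F :: "real \<Rightarrow> real"
  assumes "h \<le> d" "F h > 0" "F d \<le> 0" and lip: "L-lipschitz_on {h..d} F" and "T \<ge> 0"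
  shows "\<exists>y. y ` {0..T} \<subseteq> {h..d} \<and> backward_ode_solution F h T y"
proof -
  have contF: "continuous_on {h..d} F"
    using lip by (rule lipschitz_on_continuous_on)
  have "\<exists>x\<in>{h..d} \<inter> F -` {..0}. \<forall>z\<in>{h..d} \<inter> F -` {..0}. x \<le> z"
    using assms by (intro compact_attains_inf)
      (auto simp: compact_eq_bounded_closed intro!: continuous_closed_preimage[OF contF] bounded_subset[OF bounded_closed_interval])
  then obtain c where c: "h \<le> c" "c \<le> d" "F c \<le> 0"
    and c_least: "\<And>z. \<lbrakk>h \<le> z; z \<le> d; F z \<le> 0\<rbrakk> \<Longrightarrow> c \<le> z"
    by auto
  have "h < c"
    using c \<open>F h > 0\<close> by (cases "h = c") auto
  \<comment> \<open>Adding 1 allows division by \<open>A\<close> even when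
    \<open>L = 0\<close>.\<close>
  define A where "A = L + 1"
  have "A > 0"
    using lipschitz_on_nonneg[OF lip] by (simp add: A_def)
  \<comment> \<open>This \<open>M\<close> makes \<open>- ln (c - x) / A\<close> increase by exactly
    \<open>T\<close> between \<open>h\<close> and \<open>M\<close>.\<close>
  define M where "M = c - (c - h) * exp (- (A * T))"
  have "M < c"
    using \<open>h < c\<close> by (simp add: M_def)
  have "(c - h) * exp (- (A * T)) \<le> (c - h) * 1"
    using \<open>h < c\<close> \<open>A > 0\<close> \<open>T \<ge> 0\<close> by (intro mult_left_mono) auto
  then have "h \<le> M"
    by (simp add: M_def)
  have pos: "F x > 0" if "x \<in> {h..M}" for x
    using c_least[of x] that \<open>M < c\<close> \<open>c \<le> d\<close> by force
  have le: "F x \<le> A * (c - x)" if "x \<in> {h..M}" for x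
  proof -
    have "dist (F x) (F c) \<le> L * dist x c"
      using that c \<open>M < c\<close> by (intro lipschitz_onD[OF lip]) auto
    then show ?thesis
      using that c \<open>M < c\<close> by (auto simp: A_def dist_real_def algebra_simps)
  qed
  have "ln (c - M) = ln (c - h) - A * T"
    using \<open>h < c\<close> by (simp add: M_def ln_mult)
  then have "T \<le> - ln (c - M) / A - - ln (c - h) / A"
    using \<open>A > 0\<close> by (simp add: field_simps)
  moreover have "((\<lambda>x. - ln (c - x) / A) has_real_derivative 1 / (A * (c - x)))
      (at x within {h..M})" if "x \<in> {h..M}" for x
    using that \<open>M < c\<close> \<open>A > 0\<close> by (auto intro!: derivative_eq_intros)
  moreover have "1 / (A * (c - x)) \<le> 1 / F x" if "x \<in> {h..M}" for x
    using le[OF that] pos[OF that] by (intro frac_le) auto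
  moreover have "continuous_on {h..M} F"
    using \<open>M < c\<close> \<open>c \<le> d\<close> by (intro continuous_on_subset[OF contF]) auto
  ultimately obtain y where "y ` {0..T} \<subseteq> {h..M}" "backward_ode_solution F h T y"
    using backward_ode_solution_by_separation
      [where F = F and P = "\<lambda>x. - ln (c - x) / A" and P' = "\<lambda>x. 1 / (A * (c - x))"]
      \<open>h \<le> M\<close> pos by blast
  then show ?thesis
    using \<open>M < c\<close> \<open>c \<le> d\<close> by (intro exI[of _ y]) auto
qed

lemma backward_ode_solution_uminus:
  assumes "backward_ode_solution (\<lambda>x. - F (- x)) (- h) T y"
  shows "backward_ode_solution F h T (\<lambda>t. - y t)"
  using assms by (auto simp: backward_ode_solution_def integrable_neg_iff)

section \<open>Estimates for cubic polynomials\<close>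

text \<open>Four free coefficients replace the eight constants of \<open>dominating_F\<close>; this
  family is closed under the reflection \<open>x \<mapsto> - x\<close>.\<close>

definition cubic :: "real \<Rightarrow> real \<Rightarrow> real \<Rightarrow> real \<Rightarrow> real \<Rightarrow> real" where
  "cubic a0 a1 a2 a3 x = a0 + a1 * x + a2 * x ^ 2 + a3 * x ^ 3"

lemma cubic_lipschitz_on_Icc: "\<exists>L. L-lipschitz_on {a..b} (cubic a0 a1 a2 a3)"
proof -
  define R where "R = \<bar>a\<bar> + \<bar>b\<bar>"
  define L where "L = \<bar>a1\<bar> + \<bar>a2\<bar> * (R + R) + \<bar>a3\<bar> * (R * R + R * R + R * R)"
  have "L-lipschitz_on {a..b} (cubic a0 a1 a2 a3)"
  proof (rule lipschitz_onI)
    show "L \<ge> 0"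
      by (simp add: L_def R_def)
    fix x y assume "x \<in> {a..b}" "y \<in> {a..b}"
    then have R: "\<bar>x\<bar> \<le> R" "\<bar>y\<bar> \<le> R"
      by (auto simp: R_def)
    \<comment> \<open>\<open>Q\<close> is the divided difference of the cubic, obtained by factoring
      out \<open>x - y\<close>.\<close>
    define Q where "Q = a1 + a2 * (x + y) + a3 * (x * x + x * y + y * y)"
    have "\<bar>x + y\<bar> \<le> R + R"
      using R by linarith
    moreover have "\<bar>x * x\<bar> \<le> R * R" "\<bar>x * y\<bar> \<le> R * R" "\<bar>y * y\<bar> \<le> R * R"
      unfolding abs_mult using R by (intro mult_mono'; simp)+
    then have "\<bar>x * x + x * y + y * y\<bar> \<le> R * R + R * R + R * R"
      by linarith
    ultimately have "\<bar>a2 * (x + y)\<bar> \<le> \<bar>a2\<bar> * (R + R)"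
      "\<bar>a3 * (x * x + x * y + y * y)\<bar> \<le> \<bar>a3\<bar> * (R * R + R * R + R * R)"
      unfolding abs_mult by (auto intro!: mult_left_mono)
    then have "\<bar>Q\<bar> \<le> L"
      unfolding Q_def L_def by linarith
    moreover have "cubic a0 a1 a2 a3 x - cubic a0 a1 a2 a3 y = Q * (x - y)"
      by (simp add: cubic_def Q_def algebra_simps power2_eq_square power3_eq_cube)
    ultimately show "dist (cubic a0 a1 a2 a3 x) (cubic a0 a1 a2 a3 y) \<le> L * dist x y"
      by (simp add: dist_real_def abs_mult mult_right_mono)
  qed
  then show ?thesis ..
qed

lemma cubic_nonpos_above:
  assumes "a3 < 0"
  shows "\<exists>d\<ge>h. cubic a0 a1 a2 a3 d \<le> 0"
proof -
  define S where "S = \<bar>a0\<bar> + \<bar>a1\<bar> + \<bar>a2\<bar>"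
  \<comment> \<open>\<open>d \<ge> 1\<close> lets \<open>d ^ 2\<close> dominate the lower powers,
    and \<open>d \<ge> S / (- a3)\<close> lets the cubic term absorb
    \<open>S * d ^ 2\<close>.\<close>
  define d where "d = 1 + \<bar>h\<bar> + S / (- a3)"
  have "S / (- a3) \<ge> 0"
    using assms by (simp add: S_def divide_nonneg_neg)
  then have d: "d \<ge> 1" "d \<ge> h" "S / (- a3) \<le> d"
    by (auto simp: d_def)
  then have "S \<le> - a3 * d"
    using assms by (simp add: field_simps)
  then have "S * d ^ 2 \<le> - a3 * d * d ^ 2"
    by (intro mult_right_mono) auto
  moreover have "a0 \<le> \<bar>a0\<bar> * d ^ 2"
    using mult_left_mono[of 1 "d ^ 2" "\<bar>a0\<bar>"] d by simp
  moreover have "a1 * d \<le> \<bar>a1\<bar> * d ^ 2"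
    using d by (intro mult_mono) (auto simp: power2_eq_square)
  moreover have "a2 * d ^ 2 \<le> \<bar>a2\<bar> * d ^ 2"
    by (intro mult_right_mono) auto
  ultimately have "cubic a0 a1 a2 a3 d \<le> 0"
    by (simp add: cubic_def S_def algebra_simps power2_eq_square power3_eq_cube)
  with d show ?thesis
    by blast
qed

text \<open>For \<open>x \<le> B\<close> all terms are bounded in terms of \<open>B\<close>, and
  \<open>x + B + 1 \<ge> 1\<close>. For larger \<open>x\<close>, the quadratic and cubic terms
  together add at most 1. As \<open>x\<close> is then positive, one-sided bounds on
  \<open>a2\<close> and \<open>a3\<close> are enough there.\<close>

lemma cubic_le_linear:
  assumes coeffs: "\<bar>a0\<bar> \<le> B" "\<bar>a1\<bar> \<le> B" "\<bar>a2\<bar> \<le> B" "\<bar>a3\<bar> \<le> B"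
    and \<epsilon>: "a2 \<le> \<epsilon>" "a3 \<le> \<epsilon>" "\<epsilon> * (M ^ 2 + M ^ 3) \<le> 1" "\<epsilon> \<ge> 0"
    and x: "- B \<le> x" "x \<le> M"
  shows "cubic a0 a1 a2 a3 x \<le> (1 + B + B ^ 2 + B ^ 3 + B ^ 4) * (x + B + 1)"
proof -
  have "B \<ge> 0"
    using coeffs by simp
  define A where "A = 1 + B + B ^ 2 + B ^ 3 + B ^ 4"
  have "A \<ge> 1 + B"
    using \<open>B \<ge> 0\<close> by (simp add: A_def)
  show ?thesis
  proof (cases "x \<le> B")
    case True
    with x have "\<bar>x\<bar> \<le> B"
      by simp
    have "\<bar>a1 * x\<bar> \<le> B * B" "\<bar>a2 * x ^ 2\<bar> \<le> B * B ^ 2" "\<bar>a3 * x ^ 3\<bar> \<le> B * B ^ 3"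
      unfolding abs_mult power_abs using coeffs \<open>\<bar>x\<bar> \<le> B\<close> \<open>B \<ge> 0\<close>
      by (intro mult_mono power_mono; simp)+
    then have "cubic a0 a1 a2 a3 x \<le> B + B * B + B * B ^ 2 + B * B ^ 3"
      using coeffs unfolding cubic_def by linarith
    also have "\<dots> \<le> A"
      by (simp add: A_def power2_eq_square power3_eq_cube power4_eq_xxxx)
    also have "\<dots> \<le> A * (x + B + 1)"
      using mult_left_mono[of 1 "x + B + 1" A] x \<open>A \<ge> 1 + B\<close> \<open>B \<ge> 0\<close> by simp
    finally show ?thesis
      by (simp add: A_def)
  next
    case False
    then have "x \<ge> 0"
      using \<open>B \<ge> 0\<close> by simp
    have "a2 * x ^ 2 + a3 * x ^ 3 \<le> \<epsilon> * M ^ 2 + \<epsilon> * M ^ 3"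
      using \<open>x \<ge> 0\<close> \<epsilon> x by (intro add_mono mult_mono power_mono) auto
    also have "\<dots> \<le> 1"
      using \<epsilon> by (simp add: distrib_left)
    finally have "a2 * x ^ 2 + a3 * x ^ 3 \<le> 1" .
    moreover have "a1 * x \<le> B * x"
      using coeffs \<open>x \<ge> 0\<close> by (intro mult_right_mono) auto
    ultimately have "cubic a0 a1 a2 a3 x \<le> B + B * x + 1"
      using coeffs unfolding cubic_def by linarith
    also have "\<dots> \<le> (1 + B) * (x + B + 1)"
      using \<open>B \<ge> 0\<close> \<open>x \<ge> 0\<close> by (simp add: algebra_simps)
    also have "\<dots> \<le> A * (x + B + 1)"
      using \<open>A \<ge> 1 + B\<close> \<open>B \<ge> 0\<close> \<open>x \<ge> 0\<close> by (intro mult_right_mono) auto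
    finally show ?thesis
      by (simp add: A_def)
  qed
qed

section \<open>Solutions that start where the cubic is positive\<close>

text \<open>Either the cubic is nonpositive somewhere above \<open>h\<close> and traps the solution,
  or it stays positive. The latter excludes \<open>a3 < 0\<close>, so the smallness conditions hold
  and give at most linear growth up to \<open>M\<close>.\<close>

lemma cubic_backward_ode_solution_pos:
  fixes T B :: real
  assumes "T > 0" "B > 0"
  shows "\<exists>\<epsilon>>0. \<forall>a0 a1 a2 a3 h. \<bar>a0\<bar> \<le> B \<longrightarrow> \<bar>a1\<bar> \<le> B \<longrightarrow> \<bar>a2\<bar> \<le> B \<longrightarrow> \<bar>a3\<bar> \<le> B \<longrightarrow> \<bar>h\<bar> \<le> B \<longrightarrow>
    cubic a0 a1 a2 a3 h > 0 \<longrightarrow> a3 < 0 \<or> a3 \<le> \<epsilon> \<and> a2 \<le> \<epsilon> \<longrightarrow>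
    (\<exists>y. bounded (y ` {0..T}) \<and> backward_ode_solution (cubic a0 a1 a2 a3) h T y)"
proof -
  define A where "A = 1 + B + B ^ 2 + B ^ 3 + B ^ 4"
  \<comment> \<open>\<open>ln (x + B + 1) / A\<close> increases by exactly \<open>T\<close> from
    \<open>B\<close> to \<open>M\<close>, hence by at least \<open>T\<close> from any
    \<open>h \<le> B\<close>. As \<open>M\<close> depends only on \<open>B\<close> and
    \<open>T\<close>, so does \<open>\<epsilon>\<close>.\<close>
  define M where "M = (2 * B + 1) * exp (A * T) - B - 1"
  define \<epsilon> where "\<epsilon> = 1 / (M ^ 2 + M ^ 3)"
  have "A > 0"
    using \<open>B > 0\<close> by (simp add: A_def add_pos_pos)
  have "(2 * B + 1) * exp (A * T) \<ge> (2 * B + 1) * 1"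
    using \<open>A > 0\<close> \<open>B > 0\<close> \<open>T > 0\<close> by (intro mult_left_mono) auto
  then have "M \<ge> B"
    by (simp add: M_def)
  then have M_pos: "M ^ 2 + M ^ 3 > 0"
    using \<open>B > 0\<close> by (simp add: add_pos_pos)
  then have "\<epsilon> > 0" and \<epsilon>M: "\<epsilon> * (M ^ 2 + M ^ 3) \<le> 1"
    by (simp_all add: \<epsilon>_def)
  have "\<exists>y. bounded (y ` {0..T}) \<and> backward_ode_solution (cubic a0 a1 a2 a3) h T y"
    if coeffs: "\<bar>a0\<bar> \<le> B" "\<bar>a1\<bar> \<le> B" "\<bar>a2\<bar> \<le> B" "\<bar>a3\<bar> \<le> B" and h: "\<bar>h\<bar> \<le> B"
      and Fh: "cubic a0 a1 a2 a3 h > 0" and cases: "a3 < 0 \<or> a3 \<le> \<epsilon> \<and> a2 \<le> \<epsilon>"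
    for a0 a1 a2 a3 h
  proof -
    let ?F = "cubic a0 a1 a2 a3"
    have "\<exists>y d. y ` {0..T} \<subseteq> {h..d} \<and> backward_ode_solution ?F h T y"
    proof (cases "\<exists>d\<ge>h. ?F d \<le> 0")
      case True
      then obtain d where "h \<le> d" "?F d \<le> 0"
        by blast
      moreover obtain L where "L-lipschitz_on {h..d} ?F"
        using cubic_lipschitz_on_Icc by blast
      ultimately show ?thesis
        using backward_ode_solution_below_zero[of h d ?F L T] Fh \<open>T > 0\<close> by auto
    next
      case False
      then have pos: "?F x > 0" if "x \<in> {h..M}" for x
        using that by force
      have \<epsilon>: "a3 \<le> \<epsilon>" "a2 \<le> \<epsilon>"
        using cases False cubic_nonpos_above by blast+
      have le: "?F x \<le> A * (x + B + 1)" if "x \<in> {h..M}" for x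
        unfolding A_def using that h \<open>\<epsilon> > 0\<close>
        by (intro cubic_le_linear[OF coeffs \<epsilon>(2,1) \<epsilon>M]) auto
      have x_pos: "x + B + 1 > 0" if "x \<in> {h..M}" for x
        using that h by auto
      have "ln (M + B + 1) = ln (2 * B + 1) + A * T"
        using \<open>B > 0\<close> by (simp add: M_def ln_mult)
      moreover have "ln (h + B + 1) \<le> ln (2 * B + 1)"
        using h by (intro ln_mono) auto
      ultimately have "T \<le> ln (M + B + 1) / A - ln (h + B + 1) / A"
        using \<open>A > 0\<close> by (simp add: field_simps)
      moreover have "((\<lambda>x. ln (x + B + 1) / A) has_real_derivative 1 / (A * (x + B + 1)))
          (at x within {h..M})" if "x \<in> {h..M}" for x
        using x_pos[OF that] \<open>A > 0\<close> by (auto intro!: derivative_eq_intros)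
      moreover have "1 / (A * (x + B + 1)) \<le> 1 / ?F x" if "x \<in> {h..M}" for x
        using le[OF that] pos[OF that] by (intro frac_le) auto
      moreover have "continuous_on {h..M} ?F"
        unfolding cubic_def by (intro continuous_intros)
      moreover have "h \<le> M"
        using h \<open>M \<ge> B\<close> by simp
      ultimately show ?thesis
        using backward_ode_solution_by_separation
          [where F = ?F and P = "\<lambda>x. ln (x + B + 1) / A" and P' = "\<lambda>x. 1 / (A * (x + B + 1))"] pos by blast
    qed
    then show ?thesis
      using bounded_closed_interval bounded_subset by blast
  qed
  with \<open>\<epsilon> > 0\<close> show ?thesis
    by blast
qed

section \<open>Reflection and the dominating ODE\<close>

lemma cubic_uminus: "- cubic a0 a1 a2 a3 (- x) = cubic (- a0) a1 (- a2) a3 x"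
  by (simp add: cubic_def)

theorem theorem5p4:
  fixes T K :: real
  assumes "T > 0" and "K > 0"
  shows "\<exists>\<epsilon>>0. \<forall>b1 b2 b3 \<sigma>1 \<sigma>2 f1 f2 f3 h :: real.
    (\<forall>c\<in>{b1, b2, b3, \<sigma>1, \<sigma>2, f1, f2, f3, h}. \<bar>c\<bar> \<le> K) \<longrightarrow>
    (let F = dominating_F b1 b2 b3 \<sigma>1 \<sigma>2 f1 f2 f3 in
      (\<sigma>2 * b3 < 0 \<or> F h = 0) \<or>
      (F h > 0 \<and> \<sigma>2 * b3 \<le> \<epsilon> \<and> b2 + f3 * \<sigma>2 + b3 * \<sigma>1 \<le> \<epsilon>) \<or>
      (F h < 0 \<and> \<sigma>2 * b3 \<le> \<epsilon> \<and> b2 + f3 * \<sigma>2 + b3 * \<sigma>1 \<ge> - \<epsilon>)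
      \<longrightarrow> (\<exists>y. bounded (y ` {0..T}) \<and> backward_ode_solution F h T y))"
proof -
  \<comment> \<open>One bound for \<open>h\<close> and all four coefficients: each coefficient is a
    sum of at most two constants and at most two products of constants.\<close>
  define B where "B = 2 * K + 2 * (K * K)"
  have "B > 0"
    using \<open>K > 0\<close> by (simp add: B_def add_pos_pos)
  obtain \<epsilon> where "\<epsilon> > 0" and sol: "\<And>a0 a1 a2 a3 h.
      \<lbrakk>\<bar>a0\<bar> \<le> B; \<bar>a1\<bar> \<le> B; \<bar>a2\<bar> \<le> B; \<bar>a3\<bar> \<le> B; \<bar>h\<bar> \<le> B; cubic a0 a1 a2 a3 h > 0;
        a3 < 0 \<or> a3 \<le> \<epsilon> \<and> a2 \<le> \<epsilon>\<rbrakk> \<Longrightarrow>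
      \<exists>y. bounded (y ` {0..T}) \<and> backward_ode_solution (cubic a0 a1 a2 a3) h T y"
    using cubic_backward_ode_solution_pos[OF \<open>T > 0\<close> \<open>B > 0\<close>] by metis
  have "\<exists>y. bounded (y ` {0..T}) \<and> backward_ode_solution F h T y"
    if K: "\<forall>c\<in>{b1, b2, b3, \<sigma>1, \<sigma>2, f1, f2, f3, h}. \<bar>c\<bar> \<le> K"
      and F: "F = dominating_F b1 b2 b3 \<sigma>1 \<sigma>2 f1 f2 f3"
      and cases: "(\<sigma>2 * b3 < 0 \<or> F h = 0) \<or>
        (F h > 0 \<and> \<sigma>2 * b3 \<le> \<epsilon> \<and> b2 + f3 * \<sigma>2 + b3 * \<sigma>1 \<le> \<epsilon>) \<or>
        (F h < 0 \<and> \<sigma>2 * b3 \<le> \<epsilon> \<and> b2 + f3 * \<sigma>2 + b3 * \<sigma>1 \<ge> - \<epsilon>)"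
    for b1 b2 b3 \<sigma>1 \<sigma>2 f1 f2 f3 h F
  proof -
    define a1 where "a1 = f2 + b1 + \<sigma>1 * f3"
    define a2 where "a2 = b2 + f3 * \<sigma>2 + b3 * \<sigma>1"
    define a3 where "a3 = \<sigma>2 * b3"
    have F_cubic: "F = cubic f1 a1 a2 a3"
      by (simp add: F fun_eq_iff dominating_F_def cubic_def a1_def a2_def a3_def)
    have prods: "\<bar>\<sigma>1 * f3\<bar> \<le> K * K" "\<bar>f3 * \<sigma>2\<bar> \<le> K * K" "\<bar>b3 * \<sigma>1\<bar> \<le> K * K" "\<bar>\<sigma>2 * b3\<bar> \<le> K * K"
      unfolding abs_mult using K \<open>K > 0\<close> by (intro mult_mono; simp)+
    have "\<bar>b1\<bar> \<le> K" "\<bar>b2\<bar> \<le> K" "\<bar>f1\<bar> \<le> K" "\<bar>f2\<bar> \<le> K" "\<bar>h\<bar> \<le> K" "K * K > 0"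
      using K \<open>K > 0\<close> by auto
    with prods have bds: "\<bar>f1\<bar> \<le> B" "\<bar>a1\<bar> \<le> B" "\<bar>a2\<bar> \<le> B" "\<bar>a3\<bar> \<le> B" "\<bar>h\<bar> \<le> B"
      unfolding B_def a1_def a2_def a3_def abs_le_iff by auto
    consider "F h = 0" | "F h > 0" | "F h < 0"
      by linarith
    then show ?thesis
    proof cases
      case 1
      then show ?thesis
        \<comment> \<open>At a zero of \<open>F\<close> the constant function \<open>h\<close> is a
          solution.\<close>
        by (intro exI[of _ "\<lambda>_. h"]) (auto simp: backward_ode_solution_def image_constant_conv)
    next
      case 2
      with cases have "a3 < 0 \<or> a3 \<le> \<epsilon> \<and> a2 \<le> \<epsilon>"
        by (auto simp: a2_def a3_def)
      with 2 show ?thesis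
        unfolding F_cubic by (intro sol bds) auto
    next
      case 3
      \<comment> \<open>Reflection changes the signs of \<open>f1\<close>, \<open>a2\<close> and
        \<open>h\<close> but keeps \<open>a1\<close> and \<open>a3\<close>, so the lower bound on
        \<open>a2\<close> becomes the upper bound required by \<open>sol\<close>.\<close>
      with cases have "a3 < 0 \<or> a3 \<le> \<epsilon> \<and> - a2 \<le> \<epsilon>"
        by (auto simp: a2_def a3_def)
      moreover have "cubic (- f1) a1 (- a2) a3 (- h) > 0"
        using 3 cubic_uminus[of f1 a1 a2 a3 "- h"] by (simp add: F_cubic)
      ultimately obtain y where y: "bounded (y ` {0..T})"
        "backward_ode_solution (cubic (- f1) a1 (- a2) a3) (- h) T y"
        using sol[of "- f1" a1 "- a2" a3 "- h"] bds by auto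
      have "backward_ode_solution F h T (\<lambda>t. - y t)"
        using y(2) by (intro backward_ode_solution_uminus) (simp add: F_cubic cubic_uminus)
      moreover have "bounded ((\<lambda>t. - y t) ` {0..T})"
        using y(1) by (auto simp: bounded_iff)
      ultimately show ?thesis
        by blast
    qed
  qed
  with \<open>\<epsilon> > 0\<close> show ?thesis
    unfolding Let_def by blast
qed

end
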